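(* Let $P$ be the true transition kernel of a discounted MDP, $\hat P$ a candidate kernel (model), and $\Pi$ a class of policies. Let $\widetilde D$ be any divergence between one-step transition kernels, and let $C(\pi,\hat P,s,a)$ be a state-action dependent cost term such that for any policy $\pi$ and model $\hat P$, the value-gap is bounded by the $d_\pi$-weighted divergence: $$|V_\pi(P)-V_\pi(\hat P)|\le \mathbb E_{(s,a)\sim d_\pi}\big[C(\pi,\hat P,s,a)\cdot\widetilde D\big(P(\cdot\mid s,a),\hat P(\cdot\mid s,a)\big)\big].$$ Furthermore, assume that a $\kappa$-coverage data distribution $d_{\mathrm{data}}$ on state-action pairs exists, i.e. such that $d_\pi(s,a)\le\kappa\, d_{\mathrm{data}}(s,a)$ for all $(s,a)$ and all $\pi\in\Pi$. Then the uniform value-gap is bounded by the $d_{\mathrm{data}}$-weighted divergence: $$\sup_{\pi\in\Pi}|V_\pi(P)-V_\pi(\hat P)|\le\kappa\cdot\sup_{\pi\in\Pi}\mathbb E_{(s,a)\sim d_{\mathrm{data}}}\big[C(\pi,\hat P,s,a)\,\widetilde D\big(P(\cdot\mid s,a),\hat P(\cdot\mid s,a)\big)\big].$$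
   Context: An MDP has state space $\mathscr S$, action space $\mathscr A$, transition kernel $P(\cdot\mid s,a)$, reward $r(s,a)\in[0,R_{\max}]$, discount $\gamma\in(0,1)$ and initial state law $\rho_0$. For a kernel $Q$, $V_\pi(Q)$ is the expected discounted return $\mathbb E[\sum_{t\ge0}\gamma^t r(s_t,a_t)]$ of policy $\pi$ from $s_0\sim\rho_0$ when transitions follow $Q$. $d_\pi(s,a)=\mathbb E[\sum_{t\ge0}\gamma^t\mathbf 1\{(s_t,a_t)=(s,a)\}]$ is the unnormalized discounted occupancy of $\pi$ under the true kernel $P$, and $\mathbb E_{(s,a)\sim d_\pi}[f]$ means $\sum_{s,a}d_\pi(s,a)f(s,a)$ (no normalization).
   Formalization: The cost term C is additionally assumed nonnegative; without this the claim fails, for example when C is negative at a state-action pair that the policies never visit but the data distribution does. *)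

theory Defs
  imports "HOL-Probability.Probability"
begin

text \<open>
  States and actions are discrete: all kernels are given by probability mass functions, so no
  cardinality restriction on the types is needed.  Policies are stationary and randomized.
\<close>

type_synonym ('s, 'a) kernel = "'s \<Rightarrow> 'a \<Rightarrow> 's pmf"
type_synonym ('s, 'a) policy = "'s \<Rightarrow> 'a pmf"

definition choose_action :: "('s, 'a) policy \<Rightarrow> 's pmf \<Rightarrow> ('s \<times> 'a) pmf" where
  "choose_action \<pi> \<mu> = bind_pmf \<mu> (\<lambda>s. map_pmf (Pair s) (\<pi> s))"

text \<open>Law of \<open>(s\<^sub>n, a\<^sub>n)\<close> given the path \<open>\<omega>\<close> up to time \<open>n - 1\<close>.\<close>

definition path_step ::
  "'s pmf \<Rightarrow> ('s, 'a) kernel \<Rightarrow> ('s, 'a) policy \<Rightarrow> nat \<Rightarrow> (nat \<Rightarrow> 's \<times> 'a) \<Rightarrow> ('s \<times> 'a) measure" where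
  "path_step \<rho>0 Q \<pi> n \<omega> =
     measure_pmf (choose_action \<pi>
       (case n of 0 \<Rightarrow> \<rho>0 | Suc m \<Rightarrow> Q (fst (\<omega> m)) (snd (\<omega> m))))"

lemma Ionescu_Tulcea_path_step:
  "Ionescu_Tulcea (path_step \<rho>0 Q \<pi>) (\<lambda>_. count_space UNIV)"
proof (rule Ionescu_Tulcea.intro)
  fix n
  show "path_step \<rho>0 Q \<pi> n
    \<in> Pi\<^sub>M {0..<n} (\<lambda>_. count_space UNIV) \<rightarrow>\<^sub>M subprob_algebra (count_space UNIV)"
  proof (cases n)
    case 0
    then show ?thesis
      by (simp add: path_step_def[abs_def] measure_pmf_in_subprob_algebra)
  next
    case (Suc m)
    define k where "k = (\<lambda>x. measure_pmf (choose_action \<pi> (Q (fst x) (snd x))))"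
    have "(\<lambda>\<omega>. \<omega> m) \<in> Pi\<^sub>M {0..<n} (\<lambda>_. count_space UNIV) \<rightarrow>\<^sub>M count_space UNIV"
      using Suc by (intro measurable_component_singleton) auto
    moreover have "k \<in> count_space UNIV \<rightarrow>\<^sub>M subprob_algebra (count_space UNIV)"
      by (simp add: k_def measure_pmf_in_subprob_algebra)
    ultimately have "(\<lambda>\<omega>. k (\<omega> m))
        \<in> Pi\<^sub>M {0..<n} (\<lambda>_. count_space UNIV) \<rightarrow>\<^sub>M subprob_algebra (count_space UNIV)"
      by (rule measurable_compose)
    then show ?thesis
      using Suc by (simp add: path_step_def[abs_def] k_def)
  qed
next
  fix n \<omega>
  show "prob_space (path_step \<rho>0 Q \<pi> n \<omega>)"
    unfolding path_step_def by (rule measure_pmf.prob_space_axioms)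
qed

text \<open>Law of the infinite path \<open>(s\<^sub>0, a\<^sub>0), (s\<^sub>1, a\<^sub>1), \<dots>\<close>: the Ionescu-Tulcea measure of \<open>path_step\<close>.\<close>

definition path_measure ::
  "'s pmf \<Rightarrow> ('s, 'a) kernel \<Rightarrow> ('s, 'a) policy \<Rightarrow> (nat \<Rightarrow> 's \<times> 'a) measure" where
  "path_measure \<rho>0 Q \<pi> =
     projective_family.lim UNIV
       (Ionescu_Tulcea.CI (path_step \<rho>0 Q \<pi>) (\<lambda>_. count_space UNIV))
       (\<lambda>_. count_space UNIV)"

lemma prob_space_path_measure: "prob_space (path_measure \<rho>0 Q \<pi>)"
proof -
  interpret Ionescu_Tulcea "path_step \<rho>0 Q \<pi>" "\<lambda>_. count_space UNIV"
    by (rule Ionescu_Tulcea_path_step)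
  have "emeasure PF.lim (PF.emb UNIV {} {\<lambda>_. undefined}) = emeasure (CI {}) {\<lambda>_. undefined}"
    by (rule lim) (auto simp: PiM_empty)
  moreover have "PF.emb UNIV {} {\<lambda>_. undefined} = space PF.lim"
    by (auto simp: prod_emb_def space_PiM)
  moreover have "emeasure (CI {}) {\<lambda>_. undefined} = 1"
    using prob_space.emeasure_space_1[OF PF.prob_space_P[of "{}"]]
    by (simp add: PF.space_P space_PiM)
  ultimately show ?thesis
    unfolding path_measure_def by (intro prob_spaceI) simp
qed

definition policy_value ::
  "('s \<Rightarrow> 'a \<Rightarrow> real) \<Rightarrow> real \<Rightarrow> 's pmf \<Rightarrow> ('s, 'a) policy \<Rightarrow> ('s, 'a) kernel \<Rightarrow> real" where
  "policy_value r \<gamma> \<rho>0 \<pi> Q =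
     (\<integral>\<omega>. (\<Sum>t. \<gamma> ^ t * r (fst (\<omega> t)) (snd (\<omega> t))) \<partial>path_measure \<rho>0 Q \<pi>)"

definition occupancy ::
  "real \<Rightarrow> 's pmf \<Rightarrow> ('s, 'a) kernel \<Rightarrow> ('s, 'a) policy \<Rightarrow> 's \<times> 'a \<Rightarrow> real" where
  "occupancy \<gamma> \<rho>0 P \<pi> x =
     (\<integral>\<omega>. (\<Sum>t. \<gamma> ^ t * indicator {x} (\<omega> t)) \<partial>path_measure \<rho>0 P \<pi>)"

text \<open>
  The weights \<open>d\<close> are nonnegative but need not sum to \<open>1\<close>.  With integrands in \<open>[0, \<infinity>]\<close> the sum
  always exists, so divergences that can be infinite are covered.
\<close>

definition weighted_sum :: "('s \<times> 'a \<Rightarrow> real) \<Rightarrow> ('s \<Rightarrow> 'a \<Rightarrow> ennreal) \<Rightarrow> ennreal" where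
  "weighted_sum d f = (\<Sum>\<^sub>\<infinity>(s, a)\<in>UNIV. ennreal (d (s, a)) * f s a)"

text \<open>
  Nonnegativity is part of the type.  Separation (\<open>D p q = 0 \<Longrightarrow> p = q\<close>) is not demanded, so that
  value-aware or integral-probability discrepancies also count as divergences.
\<close>

definition divergence :: "('s pmf \<Rightarrow> 's pmf \<Rightarrow> ennreal) \<Rightarrow> bool" where
  "divergence D \<longleftrightarrow> (\<forall>p. D p p = 0)"

definition coverage ::
  "real \<Rightarrow> ('s \<times> 'a) pmf \<Rightarrow> (('s, 'a) policy \<Rightarrow> 's \<times> 'a \<Rightarrow> real) \<Rightarrow> ('s, 'a) policy set \<Rightarrow> bool" where
  "coverage \<kappa> d_data d Pols \<longleftrightarrow> (\<forall>\<pi>\<in>Pols. \<forall>x. d \<pi> x \<le> \<kappa> * pmf d_data x)"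

end

theory Submission
  imports Defs
begin

text \<open>Coverage dominates every occupancy pointwise by \<kappa> times one fixed distribution,
  and cost times divergence is nonnegative. Changing the weights in the assumed gap bound therefore
  only enlarges the sum, by a factor \<kappa> at most; this is
  \<open>weighted_sum_le_scaled\<close>. Bounding the new sum by its supremum over the class gives a
  bound common to all policies. Values in [0, \<infinity>] remove every question of convergence or
  finiteness.\<close>

lemma weighted_sum_le_scaled:
  assumes "\<And>x. d x \<le> \<kappa> * d' x" and "\<And>x. 0 \<le> d' x"
  shows "weighted_sum d f \<le> ennreal \<kappa> * weighted_sum d' f"
proof -
  \<comment> \<open>The product splits because \<open>d' x\<close> is nonnegative; for negative
    \<kappa> both sides are truncated to 0.\<close>
  have "ennreal (d x) \<le> ennreal \<kappa> * ennreal (d' x)" for x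
    using assms[of x] by (metis ennreal_leI ennreal_mult'')
  then have "weighted_sum d f
      \<le> (\<Sum>\<^sub>\<infinity>x. ennreal \<kappa> * (case x of (s, a) \<Rightarrow> ennreal (d' (s, a)) * f s a))"
    unfolding weighted_sum_def
    by (intro infsum_mono nonneg_summable_on_complete)
       (auto simp: mult.assoc[symmetric] intro!: mult_right_mono)
  \<comment> \<open>A sum in [0, \<infinity>] is the supremum of its finite partial sums, and a
    constant factor passes through both, even when the total is infinite.\<close>
  also have "\<dots> = ennreal \<kappa> * weighted_sum d' f"
    unfolding weighted_sum_def by (simp add: nonneg_infsum_complete SUP_mult_left_ennreal sum_distrib_left)
  finally show ?thesis .
qed

theorem lemma4:
  fixes P Phat :: "('s, 'a) kernel"
    and \<rho>0 :: "'s pmf"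
    and r :: "'s \<Rightarrow> 'a \<Rightarrow> real"
    and Rmax \<gamma> \<kappa> :: real
    and Pols :: "('s, 'a) policy set"
    and D :: "'s pmf \<Rightarrow> 's pmf \<Rightarrow> ennreal"
    and C :: "('s, 'a) policy \<Rightarrow> ('s, 'a) kernel \<Rightarrow> 's \<Rightarrow> 'a \<Rightarrow> real"
    and d_data :: "('s \<times> 'a) pmf"
  assumes reward: "\<And>s a. r s a \<in> {0..Rmax}"
    and discount: "\<gamma> \<in> {0<..<1}"
    and div: "divergence D"
    and cost_nonneg: "\<And>\<pi> Q s a. 0 \<le> C \<pi> Q s a"
    and gap_bound: "\<And>\<pi> Q. ennreal \<bar>policy_value r \<gamma> \<rho>0 \<pi> P - policy_value r \<gamma> \<rho>0 \<pi> Q\<bar>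
          \<le> weighted_sum (occupancy \<gamma> \<rho>0 P \<pi>) (\<lambda>s a. ennreal (C \<pi> Q s a) * D (P s a) (Q s a))"
    and cover: "coverage \<kappa> d_data (occupancy \<gamma> \<rho>0 P) Pols"
  shows "(SUP \<pi>\<in>Pols. ennreal \<bar>policy_value r \<gamma> \<rho>0 \<pi> P - policy_value r \<gamma> \<rho>0 \<pi> Phat\<bar>)
    \<le> ennreal \<kappa> * (SUP \<pi>\<in>Pols. weighted_sum (pmf d_data)
          (\<lambda>s a. ennreal (C \<pi> Phat s a) * D (P s a) (Phat s a)))"
proof (rule SUP_least)
  fix \<pi> assume \<pi>: "\<pi> \<in> Pols"
  \<comment> \<open>The integrand still depends on the policy through \<open>C\<close>, so the
    supremum on the right survives the passage to \<open>d_data\<close>.\<close>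
  define F where "F = (\<lambda>\<pi> s a. ennreal (C \<pi> Phat s a) * D (P s a) (Phat s a))"
  have "ennreal \<bar>policy_value r \<gamma> \<rho>0 \<pi> P - policy_value r \<gamma> \<rho>0 \<pi> Phat\<bar>
      \<le> weighted_sum (occupancy \<gamma> \<rho>0 P \<pi>) (F \<pi>)"
    using gap_bound unfolding F_def .
  also have "\<dots> \<le> ennreal \<kappa> * weighted_sum (pmf d_data) (F \<pi>)"
    using cover \<pi> by (intro weighted_sum_le_scaled) (auto simp: coverage_def)
  also have "\<dots> \<le> ennreal \<kappa> * (SUP \<pi>\<in>Pols. weighted_sum (pmf d_data) (F \<pi>))"
    using \<pi> by (intro mult_left_mono SUP_upper) auto
  finally show "ennreal \<bar>policy_value r \<gamma> \<rho>0 \<pi> P - policy_value r \<gamma> \<rho>0 \<pi> Phat\<bar>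
      \<le> ennreal \<kappa> * (SUP \<pi>\<in>Pols. weighted_sum (pmf d_data)
          (\<lambda>s a. ennreal (C \<pi> Phat s a) * D (P s a) (Phat s a)))"
    unfolding F_def .
qed

end
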